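(* Let $(\theta_1,\dots,\theta_n)\in\mathbb C^n$. Then the following are equivalent: (1) $(\theta_1,\dots,\theta_n)\in b\mathbf{\Theta}_n$. (2) $(\theta_1,\dots,\theta_{n-1},\theta_n^p)\in b\Gamma_n$.
   Context: $\mathbb D$ is the open unit disc, $\mathbb T$ the unit circle. Fix positive integers $m,p$ with $p$ dividing $m$, and $n\ge2$. Let $s_i$ be the $i$-th elementary symmetric polynomial in $n$ variables and $\mathbf s=(s_1,\dots,s_n)$. Define $\theta:\mathbb C^n\to\mathbb C^n$ by $\theta(z)=\big(s_1(z_1^m,\dots,z_n^m),\dots,s_{n-1}(z_1^m,\dots,z_n^m),(z_1\cdots z_n)^{m/p}\big)$, and set $\mathbf{\Theta}_n=\theta(\mathbb D^n)$, $\overline{\mathbf{\Theta}}_n=\theta(\overline{\mathbb D}^n)$, $\Gamma_n=\mathbf s(\overline{\mathbb D}^n)$. The distinguished boundaries $b\mathbf{\Theta}_n$ and $b\Gamma_n$ are the Shilov boundaries of $\overline{\mathbf{\Theta}}_n$ and $\Gamma_n$, i.e. the smallest closed subsets on which every function continuous on the compact set and holomorphic in its interior attains its maximum modulus (they are known to equal $\theta(\mathbb T^n)$ and $\mathbf s(\mathbb T^n)$ respectively). *)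

theory Defs
  imports "HOL-Analysis.Analysis"
begin

text \<open>
  Complex n-space is \<^typ>\<open>complex ^ 'n\<close> for a finite linearly ordered index type
  \<^typ>\<open>'n\<close>.  The order is only used to number the coordinates \<open>1, \<dots>, n\<close>:
  \<open>coord_index i\<close> is the position of \<open>i\<close>, so that the last coordinate is the one
  with \<open>coord_index i = CARD('n)\<close>.
\<close>

definition coord_index :: "'n::{finite,linorder} \<Rightarrow> nat"
  where "coord_index i = card {j. j \<le> i}"

definition elem_sym :: "nat \<Rightarrow> complex ^ 'n \<Rightarrow> complex"
  where "elem_sym k z = (\<Sum>I | card I = k. \<Prod>j\<in>I. z $ j)"

definition sym_map :: "complex ^ 'n::{finite,linorder} \<Rightarrow> complex ^ 'n::{finite,linorder}"
  where "sym_map z = (\<chi> i. elem_sym (coord_index i) z)"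

definition theta_map :: "nat \<Rightarrow> nat \<Rightarrow> complex ^ 'n::{finite,linorder} \<Rightarrow> complex ^ 'n::{finite,linorder}"
  where "theta_map m p z =
    (\<chi> i. if coord_index i = CARD('n) then (\<Prod>j\<in>UNIV. z $ j) ^ (m div p)
         else elem_sym (coord_index i) (\<chi> j. (z $ j) ^ m))"

definition closed_polydisc :: "(complex ^ 'n) set"
  where "closed_polydisc = {z. \<forall>i. z $ i \<in> cball 0 1}"

definition closed_Theta :: "nat \<Rightarrow> nat \<Rightarrow> (complex ^ 'n::{finite,linorder}) set"
  where "closed_Theta m p = theta_map m p ` closed_polydisc"

definition Gamma_set :: "(complex ^ 'n::{finite,linorder}) set"
  where "Gamma_set = sym_map ` closed_polydisc"

text \<open>
  Holomorphy in several variables: complex differentiability at each point, i.e. the real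
  Frechet derivative exists and is complex linear.
\<close>

definition holomorphic_several :: "(complex ^ 'n \<Rightarrow> complex) \<Rightarrow> (complex ^ 'n) set \<Rightarrow> bool"
  where "holomorphic_several f U \<longleftrightarrow>
    (\<forall>x\<in>U. \<exists>f'. (f has_derivative f') (at x) \<and> (\<forall>c v. f' (c *s v) = c * f' v))"

definition disc_algebra :: "(complex ^ 'n) set \<Rightarrow> (complex ^ 'n \<Rightarrow> complex) set"
  where "disc_algebra K = {f. continuous_on K f \<and> holomorphic_several f (interior K)}"

definition max_modulus_set :: "(complex ^ 'n) set \<Rightarrow> (complex ^ 'n) set \<Rightarrow> bool"
  where "max_modulus_set K B \<longleftrightarrow>
    closed B \<and> B \<subseteq> K \<and> (\<forall>f\<in>disc_algebra K. \<exists>x\<in>B. \<forall>y\<in>K. cmod (f y) \<le> cmod (f x))"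

text \<open>
  \<open>LEAST\<close> is with respect to inclusion; it is meaningful because, for the compact sets
  used here, a smallest such subset exists.
\<close>

definition shilov_boundary :: "(complex ^ 'n) set \<Rightarrow> (complex ^ 'n) set"
  where "shilov_boundary K = (LEAST B. max_modulus_set K B)"

definition b_Theta :: "nat \<Rightarrow> nat \<Rightarrow> (complex ^ 'n::{finite,linorder}) set"
  where "b_Theta m p = shilov_boundary (closed_Theta m p)"

definition b_Gamma :: "(complex ^ 'n::{finite,linorder}) set"
  where "b_Gamma = shilov_boundary Gamma_set"

end

theory Submission
  imports Defs "HOL-Complex_Analysis.Conformal_Mappings"
    "HOL-Computational_Algebra.Fundamental_Theorem_Algebra"
begin

text \<open>
  Write \<open>T\<close> for the unit circle.  The theorem reduces to two facts.

  First, the Shilov boundaries are the images of the torus \<open>T\<^sup>n\<close> under \<^const>\<open>theta_map\<close> and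
  \<^const>\<open>sym_map\<close>.  As \<^const>\<open>sym_map\<close> is \<^const>\<open>theta_map\<close> with \<open>m = p = 1\<close>, one proof covers both
  (\<open>shilov_boundary_closed_Theta\<close>).

  Second, raising the last coordinate to the power \<open>p\<close> carries \<open>theta_map m p z\<close> to
  \<open>sym_map (z\<^sub>1\<^sup>m, \<dots>, z\<^sub>n\<^sup>m)\<close>, and a point whose image lies in \<open>sym_map (T\<^sup>n)\<close> already lies in the image of
  the torus, because \<open>m\<close>-th roots of the coordinates can be chosen so that their product has the
  prescribed last coordinate (\<open>theta_map_image_iff\<close>).

  For the Shilov boundary, the torus dominates: a function \<open>f\<close> of the algebra pulls back to a
  function on the closed polydisc that is holomorphic inside, and the maximum principle in each
  variable moves a maximum point to the torus.  Holomorphy of the pullback on the open polydisc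
  requires that the image of the open polydisc lies in the interior of the compact set.  This holds
  because \<^const>\<open>sym_map\<close> is proper and surjective with saturated polydiscs, hence maps open polydiscs to
  open sets.

  Conversely every image \<open>w\<close> of a torus point \<open>t\<close> belongs to each closed set with the maximum
  property.  For this it is enough to find, for each neighbourhood of \<open>w\<close>, a function of
  the algebra that is larger in modulus at \<open>w\<close> than anywhere outside the neighbourhood
  (\<open>almost_peak_function\<close>).  Such functions are built from products
  \<open>\<Prod>j. h ((z $ j) ^ m)\<close> with one-variable polynomials \<open>h\<close>, which descend to entire functions of the
  image point, multiplied by a polynomial that separates finitely many points.
\<close>

section \<open>Numbering the coordinates\<close>

lemma bij_coord_index: "bij_betw (coord_index :: 'n::{finite,linorder} \<Rightarrow> nat) UNIV {1..CARD('n)}"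
proof -
  have less: "coord_index i < coord_index j" if "i < j" for i j :: 'n
    unfolding coord_index_def using that by (intro psubset_card_mono psubsetI) (auto simp: set_eq_iff intro: exI[of _ j])
  have inj: "inj (coord_index :: 'n \<Rightarrow> nat)"
    by (rule injI) (metis less less_irrefl neqE)
  have "coord_index i \<in> {1..CARD('n)}" for i :: 'n
  proof -
    have "card {i} \<le> coord_index i" "coord_index i \<le> CARD('n)"
      unfolding coord_index_def by (intro card_mono; auto)+
    then show ?thesis by simp
  qed
  then have "range (coord_index :: 'n \<Rightarrow> nat) = {1..CARD('n)}"
    by (intro card_subset_eq) (auto simp: card_image[OF inj])
  with inj show ?thesis by (simp add: bij_betw_def)
qed

lemma ex_last_coord: "\<exists>l :: 'n::{finite,linorder}. coord_index l = CARD('n)"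
proof -
  have "CARD('n) \<in> {1..CARD('n)}" by (simp add: Suc_leI)
  then show ?thesis
    using bij_coord_index[where 'n='n] unfolding bij_betw_def by (metis imageE)
qed

lemma coord_index_inject: "coord_index i = coord_index j \<longleftrightarrow> i = j"
  using bij_coord_index unfolding bij_betw_def inj_on_def by blast

lemma coord_index_bounds: "1 \<le> coord_index (i :: 'n::{finite,linorder})" "coord_index i \<le> CARD('n)"
  using bij_betwE[OF bij_coord_index[where 'n='n]] by auto

section \<open>The roots of a monic polynomial and the symmetrization map\<close>

text \<open>
  The coefficients carry no alternating signs, so for \<open>w = sym_map z\<close> the polynomial is
  \<open>\<Prod>j. (z $ j + X)\<close>, whose roots are the numbers \<open>- z $ j\<close>.  The coordinate of \<open>w\<close> with
  number \<open>k\<close> sits in degree \<open>n - k\<close>.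
\<close>
definition monic_poly :: "complex ^ 'n::{finite,linorder} \<Rightarrow> complex poly"
  where "monic_poly w = monom 1 CARD('n) + (\<Sum>i\<in>UNIV. monom (w $ i) (CARD('n) - coord_index i))"

lemma poly_monic_poly:
  "poly (monic_poly w) a = a ^ CARD('n) + (\<Sum>i\<in>UNIV. w $ i * a ^ (CARD('n) - coord_index i))"
  for w :: "complex ^ 'n::{finite,linorder}"
  by (simp add: monic_poly_def poly_monom poly_sum)

lemma coeff_monic_poly: "coeff (monic_poly w) (CARD('n) - coord_index i) = w $ i"
  for w :: "complex ^ 'n::{finite,linorder}"
proof -
  have eq: "CARD('n) - coord_index j = CARD('n) - coord_index i \<longleftrightarrow> j = i" for j :: 'n
    using coord_index_bounds[of i] coord_index_bounds[of j] coord_index_inject[of i j] by auto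
  have "CARD('n) \<noteq> CARD('n) - coord_index i"
    using coord_index_bounds[of i] by auto
  then show ?thesis
    by (simp add: monic_poly_def coeff_sum eq)
qed

text \<open>
  Vieta: expanding the product chooses for each \<open>j\<close> either \<open>z $ j\<close> or \<open>a\<close>; grouping the
  choices by the number of factors \<open>z $ j\<close> produces the elementary symmetric polynomials.
\<close>
lemma poly_monic_poly_sym_map: "poly (monic_poly (sym_map z)) a = (\<Prod>j\<in>UNIV. z $ j + a)"
  for z :: "complex ^ 'n::{finite,linorder}"
proof -
  let ?n = "CARD('n)"
  have "(\<Prod>j\<in>UNIV. z $ j + a) = (\<Sum>X\<in>UNIV. (\<Prod>j\<in>X. z $ j) * a ^ (?n - card X))"
    by (simp add: prod_add card_Diff_subset)
  also have "\<dots> = (\<Sum>k\<in>{0..?n}. \<Sum>X | X \<in> UNIV \<and> card X = k. (\<Prod>j\<in>X. z $ j) * a ^ (?n - card X))"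
    by (rule sum.group[symmetric]) (auto simp: card_mono)
  also have "\<dots> = (\<Sum>k\<in>{0..?n}. elem_sym k z * a ^ (?n - k))"
    by (simp add: elem_sym_def sum_distrib_right)
  also have "\<dots> = elem_sym 0 z * a ^ ?n + (\<Sum>k\<in>{1..?n}. elem_sym k z * a ^ (?n - k))"
    by (simp add: sum.atLeast_Suc_atMost)
  also have "elem_sym 0 z = 1"
    by (simp add: elem_sym_def)
  also have "(\<Sum>k\<in>{1..?n}. elem_sym k z * a ^ (?n - k)) =
      (\<Sum>i\<in>UNIV. sym_map z $ i * a ^ (?n - coord_index i))"
    by (subst sum.reindex_bij_betw[OF bij_coord_index, symmetric]) (simp add: sym_map_def)
  finally show ?thesis by (simp add: poly_monic_poly)
qed

lemma degree_monic_poly: "degree (monic_poly w) = CARD('n)" "lead_coeff (monic_poly w) = 1"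
  for w :: "complex ^ 'n::{finite,linorder}"
proof -
  have le: "degree (\<Sum>i\<in>UNIV. monom (w $ i) (CARD('n) - coord_index i)) \<le> CARD('n) - 1"
    using coord_index_bounds
    by (intro degree_sum_le) (auto intro!: order.trans[OF degree_monom_le] diff_le_mono2)
  have "0 < CARD('n)" by simp
  with le have "degree (\<Sum>i\<in>UNIV. monom (w $ i) (CARD('n) - coord_index i)) < CARD('n)"
    by linarith
  then have lt: "degree (\<Sum>i\<in>UNIV. monom (w $ i) (CARD('n) - coord_index i)) < degree (monom (1::complex) CARD('n))"
    by (simp add: degree_monom_eq)
  then show "degree (monic_poly w) = CARD('n)" "lead_coeff (monic_poly w) = 1"
    unfolding monic_poly_def
    by (simp_all add: degree_add_eq_left lead_coeff_add_le degree_monom_eq coeff_eq_0)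
qed

text \<open>
  The fundamental theorem of algebra splits the monic polynomial with coefficients \<open>w\<close>; its
  negated roots, listed in any order, form a preimage of \<open>w\<close>.
\<close>
lemma surj_sym_map: "\<exists>z. sym_map z = w" for w :: "complex ^ 'n::{finite,linorder}"
proof -
  obtain r where "monic_poly w = (\<Prod>k<CARD('n). [:- r k, 1:])"
    using complex_poly_decompose'[of "monic_poly w"] degree_monic_poly[of w]
    by (metis smult_1_left)
  then have fact: "poly (monic_poly w) a = (\<Prod>k<CARD('n). a - r k)" for a
    by (simp add: poly_prod)
  obtain b :: "'n \<Rightarrow> nat" where b: "bij_betw b UNIV {..<CARD('n)}"
    using ex_bij_betw_finite_nat[of "UNIV :: 'n set"] by (auto simp: lessThan_atLeast0)
  define z :: "complex ^ 'n::{finite,linorder}" where "z = (\<chi> j. - r (b j))"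
  have "poly (monic_poly (sym_map z)) a = poly (monic_poly w) a" for a
    using prod.reindex_bij_betw[OF b, of "\<lambda>k. a - r k"]
    by (simp add: fact poly_monic_poly_sym_map z_def)
  then have "monic_poly (sym_map z) = monic_poly w"
    by (simp add: poly_eq_poly_eq_iff[symmetric] fun_eq_iff)
  then have "sym_map z $ i = w $ i" for i
    by (metis coeff_monic_poly)
  then show ?thesis by (metis vec_eq_iff)
qed

text \<open>
  The symmetric functions determine the polynomial, hence its set of roots.  Multiplicities are
  left out because the conditions imposed on points below concern each coordinate separately.
\<close>
lemma range_eq_if_sym_map_eq:
  fixes u z :: "complex ^ 'n::{finite,linorder}"
  assumes "sym_map u = sym_map z"
  shows "range (($) u) = range (($) z)"
proof -
  have *: "- a \<in> range (($) v) \<longleftrightarrow> poly (monic_poly (sym_map v)) a = 0" for a and v :: "complex ^ 'n::{finite,linorder}"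
    by (auto simp: poly_monic_poly_sym_map add_eq_0_iff image_iff) (metis add.inverse_inverse)
  have "a \<in> range (($) u) \<longleftrightarrow> a \<in> range (($) z)" for a
    using *[of "- a" u] *[of "- a" z] assms by simp
  then show ?thesis by blast
qed

definition cart_power :: "complex set \<Rightarrow> (complex ^ 'n) set"
  where "cart_power S = {z. \<forall>j. z $ j \<in> S}"

text \<open>
  Powers \<open>S\<^sup>n\<close> are saturated for the symmetrization map.  This lets membership in the image be
  read off from any single preimage.
\<close>
lemma sym_map_in_image_iff: "sym_map u \<in> sym_map ` cart_power S \<longleftrightarrow> u \<in> cart_power S"
proof
  assume "sym_map u \<in> sym_map ` cart_power S"
  then obtain z where "z \<in> cart_power S" "sym_map u = sym_map z" by auto
  then have "range (($) u) \<subseteq> S"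
    using range_eq_if_sym_map_eq[of u z] by (auto simp: cart_power_def)
  then show "u \<in> cart_power S" by (auto simp: cart_power_def)
qed auto

text \<open>
  Lagrange's bound for the roots of a monic polynomial.  It says that the symmetrization map is
  proper, from which closedness follows.
\<close>
lemma sym_map_coordinate_bound:
  assumes "sym_map u = w"
  shows "cmod (u $ j) \<le> 1 + (\<Sum>i\<in>UNIV. cmod (w $ i))"
proof (cases "cmod (u $ j) \<le> 1")
  case True
  then show ?thesis by (simp add: add_increasing2 sum_nonneg)
next
  case False
  let ?n = "CARD('a)" and ?a = "- u $ j"
  have a: "1 \<le> cmod ?a" using False by simp
  have "poly (monic_poly w) ?a = 0"
    unfolding assms[symmetric] poly_monic_poly_sym_map by (rule prod_zero) (auto intro: bexI[of _ j])
  then have "?a ^ ?n = - (\<Sum>i\<in>UNIV. w $ i * ?a ^ (?n - coord_index i))"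
    by (simp add: poly_monic_poly add_eq_0_iff2)
  then have "cmod ?a ^ ?n = cmod (\<Sum>i\<in>UNIV. w $ i * ?a ^ (?n - coord_index i))"
    by (metis norm_minus_cancel norm_power)
  also have "\<dots> \<le> (\<Sum>i\<in>UNIV. cmod (w $ i) * cmod ?a ^ (?n - 1))"
    unfolding norm_mult norm_power
    by (rule order.trans[OF norm_sum], rule sum_mono)
       (use a coord_index_bounds in \<open>auto simp: norm_mult norm_power intro!: mult_left_mono power_increasing diff_le_mono2\<close>)
  also have "\<dots> = (\<Sum>i\<in>UNIV. cmod (w $ i)) * cmod ?a ^ (?n - 1)"
    by (simp add: sum_distrib_right)
  finally have "cmod ?a * cmod ?a ^ (?n - 1) \<le> (\<Sum>i\<in>UNIV. cmod (w $ i)) * cmod ?a ^ (?n - 1)"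
    by (simp add: power_eq_if)
  moreover have "0 < cmod ?a ^ (?n - 1)" using a by (intro zero_less_power) linarith
  ultimately have "cmod ?a \<le> (\<Sum>i\<in>UNIV. cmod (w $ i))"
    using mult_right_le_imp_le by blast
  then show ?thesis by simp
qed

section \<open>The symmetrization map is closed and open on polydiscs\<close>

lemma continuous_on_elem_sym [continuous_intros]:
  assumes "continuous_on S f" shows "continuous_on S (\<lambda>x. elem_sym k (f x))"
  unfolding elem_sym_def by (intro continuous_intros assms)

lemma continuous_sym_map: "continuous_on S sym_map"
  unfolding sym_map_def by (intro continuous_on_vec_lambda continuous_intros)

lemma continuous_theta_map:
  "continuous_on S (theta_map m p :: complex ^ 'n::{finite,linorder} \<Rightarrow> _)"
proof -
  have "continuous_on S (\<lambda>z. if coord_index i = CARD('n) then (\<Prod>j\<in>UNIV. z $ j) ^ (m div p)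
         else elem_sym (coord_index i) (\<chi> j. (z $ j) ^ m))" for i :: 'n and S
    by (cases "coord_index i = CARD('n)") (auto intro!: continuous_intros)
  then show ?thesis
    unfolding theta_map_def by (intro continuous_on_vec_lambda)
qed

text \<open>
  The two sides of the equivalence are linked by this map: for \<open>p dvd m\<close> it carries
  the image of \<^const>\<open>theta_map\<close> into the image of \<^const>\<open>sym_map\<close>.
\<close>
definition pow_last :: "nat \<Rightarrow> complex ^ 'n::{finite,linorder} \<Rightarrow> complex ^ 'n::{finite,linorder}"
  where "pow_last p w = (\<chi> i. if coord_index i = CARD('n) then (w $ i) ^ p else w $ i)"

lemma continuous_pow_last:
  "continuous_on S (pow_last p :: complex ^ 'n::{finite,linorder} \<Rightarrow> _)"
proof -
  have "continuous_on S (\<lambda>w :: complex ^ 'n::{finite,linorder}. if coord_index i = CARD('n) then (w $ i) ^ p else w $ i)" for i :: 'n and S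
    by (cases "coord_index i = CARD('n)") (auto intro!: continuous_intros)
  then show ?thesis
    unfolding pow_last_def by (intro continuous_on_vec_lambda)
qed

text \<open>
  A convergent sequence of images has bounded preimages by the root bound, so a subsequence of
  the preimages converges, and its limit maps to the limit of the images.
\<close>
lemma closed_map_sym_map:
  fixes C :: "(complex ^ 'n::{finite,linorder}) set"
  assumes "closed C" shows "closed (sym_map ` C)"
  unfolding closed_sequential_limits
proof (intro allI impI, elim conjE)
  fix w l assume w: "\<forall>k. w k \<in> sym_map ` C" and lim: "w \<longlonglongrightarrow> l"
  from w have "\<forall>k. \<exists>u. u \<in> C \<and> sym_map u = w k" by (metis imageE)
  then obtain u where u: "\<And>k. u k \<in> C" "\<And>k. sym_map (u k) = w k" by metis
  from lim have "bounded (range w)" by (simp add: convergent_imp_bounded)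
  then obtain R where R: "\<And>k. norm (w k) \<le> R" by (auto simp: bounded_iff)
  have "cmod (u k $ j) \<le> 1 + real CARD('n) * R" for k j
  proof -
    have "(\<Sum>i\<in>UNIV. cmod (w k $ i)) \<le> real CARD('n) * R"
      using order.trans[OF Finite_Cartesian_Product.norm_nth_le R] by (intro sum_bounded_above)
    then show ?thesis using sym_map_coordinate_bound[OF u(2), of k j] by linarith
  qed
  then have "norm (u k) \<le> (\<Sum>j\<in>(UNIV::'n set). 1 + real CARD('n) * R)" for k
    unfolding norm_vec_def by (intro order.trans[OF L2_set_le_sum] sum_mono) auto
  then have "bounded (range u)" by (auto simp: bounded_iff)
  then obtain v r where r: "strict_mono (r :: nat \<Rightarrow> nat)" and v: "(u \<circ> r) \<longlonglongrightarrow> v"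
    using bounded_imp_convergent_subsequence by blast
  have "v \<in> C" using assms u(1) v closed_sequentially[of C "u \<circ> r" v] by auto
  have "continuous (at v) sym_map"
    by (metis continuous_sym_map continuous_on_eq_continuous_at open_UNIV UNIV_I)
  with v have "(\<lambda>k. sym_map ((u \<circ> r) k)) \<longlonglongrightarrow> sym_map v" by (simp add: continuous_at_sequentially o_def)
  moreover have "(\<lambda>k. sym_map ((u \<circ> r) k)) \<longlonglongrightarrow> l"
    using LIMSEQ_subseq_LIMSEQ[OF lim r] by (simp add: u(2) o_def)
  ultimately have "l = sym_map v" using LIMSEQ_unique by blast
  with \<open>v \<in> C\<close> show "l \<in> sym_map ` C" by blast
qed

lemma open_cart_power:
  assumes "open S" shows "open (cart_power S :: (complex ^ 'n) set)"
proof -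
  have "cart_power S = (\<Inter>j. (\<lambda>z :: complex ^ 'n. z $ j) -` S)"
    by (auto simp: cart_power_def)
  then show ?thesis
    using assms by (auto intro!: open_INT open_vimage_vec_nth)
qed

text \<open>
  Openness comes from closedness without any appeal to the Jacobian: since the map is surjective
  and \<open>S\<^sup>n\<close> is saturated, the image of \<open>S\<^sup>n\<close> is the complement of the image of the closed
  complement of \<open>S\<^sup>n\<close>.
\<close>
lemma open_sym_map_image:
  assumes "open S"
  shows "open (sym_map ` cart_power S :: (complex ^ 'n::{finite,linorder}) set)"
proof -
  have "sym_map ` cart_power S = - (sym_map ` (- cart_power S) :: (complex ^ 'n::{finite,linorder}) set)"
  proof (rule set_eqI)
    fix w :: "complex ^ 'n::{finite,linorder}"
    obtain u where u: "w = sym_map u" using surj_sym_map by metis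
    show "w \<in> sym_map ` cart_power S \<longleftrightarrow> w \<in> - (sym_map ` (- cart_power S))"
      using sym_map_in_image_iff[of _ S] unfolding u by (metis Compl_iff imageE imageI)
  qed
  then show ?thesis
    using closed_map_sym_map open_cart_power[OF assms] by (metis closed_Compl open_Compl)
qed

section \<open>Comparing the two maps\<close>

lemma elem_sym_top: "elem_sym CARD('n) z = (\<Prod>j\<in>UNIV. z $ j)" for z :: "complex ^ 'n"
proof -
  have "{I. card I = CARD('n)} = {UNIV :: 'n set}"
    by (auto dest: card_subset_eq[OF finite subset_UNIV])
  then show ?thesis by (simp add: elem_sym_def)
qed

lemma pow_last_theta_map:
  assumes "p dvd m"
  shows "pow_last p (theta_map m p z) = sym_map (\<chi> j. (z $ j) ^ m)"
  using assms
  by (auto simp: vec_eq_iff pow_last_def theta_map_def sym_map_def elem_sym_top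
        power_mult[symmetric] prod_power_distrib)

text \<open>
  This makes \<open>\<Gamma>\<^sub>n\<close> the special case \<open>m = p = 1\<close> of \<^const>\<open>closed_Theta\<close>, so a single
  determination of the Shilov boundary serves both.
\<close>
lemma theta_map_1: "theta_map 1 1 = sym_map"
  by (auto simp: fun_eq_iff vec_eq_iff theta_map_def sym_map_def elem_sym_top vec_lambda_eta)

text \<open>
  Taking arbitrary \<open>m\<close>-th roots of the \<open>u $ j\<close> gives a point whose image agrees with \<open>w\<close> except
  that the last coordinate may be off by a \<open>p\<close>-th root of unity \<open>\<zeta>\<close>.  Multiplying one coordinate
  by a number \<open>\<eta>\<close> with \<open>\<eta> ^ (m div p) = \<zeta>\<close> corrects this, and \<open>\<eta> ^ m = \<zeta> ^ p = 1\<close>, so the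
  \<open>m\<close>-th powers of the coordinates do not change.
\<close>
lemma theta_map_lift:
  fixes w :: "complex ^ 'n::{finite,linorder}"
  assumes "m > 0" "p > 0" "p dvd m" and eq: "pow_last p w = sym_map u"
  shows "\<exists>z. theta_map m p z = w \<and> (\<forall>j. (z $ j) ^ m = u $ j)"
proof -
  obtain l :: 'n where l: "coord_index l = CARD('n)" using ex_last_coord by blast
  define q where "q = m div p"
  have q: "q > 0" "m = p * q" using assms by (auto simp: q_def elim!: dvdE)
  have "\<forall>j. \<exists>v. u $ j = v ^ m" using assms(1) by (metis exists_complex_root less_irrefl)
  then obtain y where y: "\<And>j. y j ^ m = u $ j" by metis
  define P where "P = (\<Prod>j\<in>UNIV. y j) ^ q"
  have Pp: "P ^ p = (w $ l) ^ p"
  proof -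
    have "pow_last p (theta_map m p (\<chi> j. y j)) = pow_last p w"
      by (simp add: pow_last_theta_map assms y eq vec_lambda_eta)
    then have "pow_last p (theta_map m p (\<chi> j. y j)) $ l = pow_last p w $ l" by simp
    then show ?thesis by (simp add: pow_last_def theta_map_def l P_def q_def)
  qed
  obtain \<zeta> where \<zeta>: "\<zeta> ^ p = 1" "\<zeta> * P = w $ l"
  proof (cases "P = 0")
    case True
    then have "w $ l = 0" using Pp \<open>p > 0\<close> by (metis power_eq_0_iff zero_power)
    then show ?thesis using that[of 1] True by simp
  next
    case False
    then show ?thesis using that[of "w $ l / P"] Pp[symmetric] by (simp add: power_divide)
  qed
  obtain \<eta> where \<eta>: "\<zeta> = \<eta> ^ q" using exists_complex_root[of q] q(1) by blast
  define z where "z = (\<chi> j. (if j = l then \<eta> else 1) * y j)"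
  have zm: "(z $ j) ^ m = u $ j" for j
    using \<zeta>(1) \<eta> y[of j] q(2) by (simp add: z_def power_mult_distrib power_mult[symmetric] mult.commute)
  have "pow_last p (theta_map m p z) = pow_last p w"
    by (simp add: pow_last_theta_map assms zm eq vec_lambda_eta)
  then have *: "pow_last p (theta_map m p z) $ i = pow_last p w $ i" for i by simp
  have "theta_map m p z $ i = w $ i" if "i \<noteq> l" for i
  proof -
    have "coord_index i \<noteq> CARD('n)" using that l by (metis coord_index_inject)
    then show ?thesis using *[of i] by (simp add: pow_last_def)
  qed
  moreover have "theta_map m p z $ l = w $ l"
    using \<zeta>(2) \<eta> by (simp add: theta_map_def l z_def prod.distrib P_def power_mult_distrib q_def)
  ultimately have "theta_map m p z = w" unfolding vec_eq_iff by metis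
  with zm show ?thesis by blast
qed

text \<open>
  The proposition at the level of images.  It is used with \<open>S\<close> the open disc, to see that the
  image of the open polydisc is open, and with \<open>S\<close> the circle, for the boundaries.
\<close>
lemma theta_map_image_iff:
  assumes "m > 0" "p > 0" "p dvd m" and S: "\<And>x. x ^ m \<in> S \<longleftrightarrow> x \<in> S"
  shows "w \<in> theta_map m p ` cart_power S \<longleftrightarrow> pow_last p w \<in> sym_map ` cart_power S"
proof
  assume "w \<in> theta_map m p ` cart_power S"
  then show "pow_last p w \<in> sym_map ` cart_power S"
    using S by (auto simp: pow_last_theta_map assms cart_power_def)
next
  assume "pow_last p w \<in> sym_map ` cart_power S"
  then obtain u where u: "u \<in> cart_power S" "pow_last p w = sym_map u" by auto
  then obtain z where "theta_map m p z = w" "\<And>j. (z $ j) ^ m = u $ j"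
    using theta_map_lift[OF assms(1-3)] by blast
  moreover have "z \<in> cart_power S"
    using u(1) S[of "z $ j" for j] calculation(2) by (auto simp: cart_power_def)
  ultimately show "w \<in> theta_map m p ` cart_power S" by blast
qed

lemma power_mem_ball_iff: "0 < m \<Longrightarrow> x ^ m \<in> ball 0 1 \<longleftrightarrow> x \<in> ball (0::complex) 1"
  by (simp add: norm_power power_less_one_iff)

lemma power_mem_sphere_iff: "0 < m \<Longrightarrow> x ^ m \<in> sphere 0 1 \<longleftrightarrow> x \<in> sphere (0::complex) 1"
  using power_eq_iff_eq_base[of m "cmod x" 1] by (simp add: norm_power) 

lemma open_theta_map_polydisc:
  assumes "m > 0" "p > 0" "p dvd m"
  shows "open (theta_map m p ` cart_power (ball 0 1) :: (complex ^ 'n::{finite,linorder}) set)"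
proof -
  have "theta_map m p ` cart_power (ball 0 1) = pow_last p -` (sym_map ` cart_power (ball 0 1) :: (complex ^ 'n::{finite,linorder}) set)"
    using theta_map_image_iff[OF assms power_mem_ball_iff[OF assms(1)]] by blast
  then show ?thesis
    using open_vimage[OF open_sym_map_image[OF open_ball] continuous_pow_last] by simp
qed

section \<open>The torus dominates the polydisc\<close>

lemma has_derivative_vec_lambda_field:
  fixes f :: "complex \<Rightarrow> 'n::finite \<Rightarrow> complex"
  assumes "\<And>i. ((\<lambda>x. f x i) has_field_derivative d i) (at a)"
  shows "((\<lambda>x. \<chi> i. f x i) has_derivative (\<lambda>v. v *s (\<chi> i. d i))) (at a)"
  unfolding has_derivative_componentwise_within[of "\<lambda>x. \<chi> i. f x i"]
proof
  fix b :: "complex ^ 'n" assume "b \<in> Basis"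
  then obtain i u where b: "b = axis i u" by (auto simp: Basis_vec_def)
  have "((\<lambda>x. f x i \<bullet> u) has_derivative (\<lambda>v. (d i * v) \<bullet> u)) (at a)"
    using assms[of i] unfolding has_field_derivative_def by (rule has_derivative_inner_left)
  then show "((\<lambda>x. (\<chi> i. f x i) \<bullet> b) has_derivative (\<lambda>v. (v *s (\<chi> i. d i)) \<bullet> b)) (at a)"
    by (simp add: b inner_axis mult.commute)
qed

text \<open>
  Complex linearity of the derivative \<open>f'\<close> is exactly what turns \<open>v \<mapsto> f' (v *s d)\<close> into
  multiplication by the number \<open>f' d\<close>.
\<close>
lemma holomorphic_several_compose_curve:
  fixes \<gamma> :: "complex \<Rightarrow> complex ^ 'n"
  assumes f: "holomorphic_several f U" and V: "open V"
    and \<gamma>: "\<And>i. (\<lambda>x. \<gamma> x $ i) holomorphic_on V" "\<gamma> ` V \<subseteq> U"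
  shows "(\<lambda>x. f (\<gamma> x)) holomorphic_on V"
proof (rule holomorphic_onI)
  fix a assume a: "a \<in> V"
  define d where "d = (\<chi> i. deriv (\<lambda>x. \<gamma> x $ i) a)"
  have "(\<gamma> has_derivative (\<lambda>v. v *s d)) (at a)"
    using has_derivative_vec_lambda_field[of "\<lambda>x i. \<gamma> x $ i" "\<lambda>i. deriv (\<lambda>x. \<gamma> x $ i) a" a]
      holomorphic_derivI[OF \<gamma>(1) V a] by (simp add: d_def vec_lambda_eta)
  moreover obtain f' where f': "(f has_derivative f') (at (\<gamma> a))" "\<And>c v. f' (c *s v) = c * f' v"
    using f \<gamma>(2) a unfolding holomorphic_several_def by blast
  ultimately have "((\<lambda>x. f (\<gamma> x)) has_derivative (\<lambda>v. f' (v *s d))) (at a)"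
    using has_derivative_compose by blast
  then have "((\<lambda>x. f (\<gamma> x)) has_field_derivative f' d) (at a)"
    by (simp add: f'(2) has_field_derivative_def mult_commute_abs)
  then show "(\<lambda>x. f (\<gamma> x)) field_differentiable at a within V"
    by (meson field_differentiable_at_within field_differentiable_def)
qed

lemma holomorphic_theta_map_curve:
  assumes "\<And>j. (\<lambda>x. \<gamma> x $ j) holomorphic_on V"
  shows "(\<lambda>x. theta_map m p (\<gamma> x) $ i) holomorphic_on V"
  unfolding theta_map_def elem_sym_def
  by (cases "coord_index i = CARD('a)") (auto intro!: holomorphic_intros assms)

text \<open>
  The maximum principle in one variable moves the coordinates of \<open>z\<close> to the circle one at a
  time, never decreasing the modulus of \<open>g\<close>.  Holomorphy is required on a slightly larger disc
  because, once some coordinates lie on the circle, the remaining slices run along the boundary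
  of the polydisc.
\<close>
lemma torus_dominates:
  fixes g :: "complex ^ 'n \<Rightarrow> complex"
  assumes \<rho>: "1 < \<rho>"
    and hol: "\<And>z i. z \<in> cart_power (cball 0 1) \<Longrightarrow>
      (\<lambda>x. g (\<chi> j. if j = i then x else z $ j)) holomorphic_on ball 0 \<rho>"
    and z: "z \<in> cart_power (cball 0 1)"
  shows "\<exists>t\<in>cart_power (sphere 0 1). cmod (g z) \<le> cmod (g t)"
proof -
  have "\<exists>y\<in>cart_power (cball 0 1). (\<forall>j\<in>S. y $ j \<in> sphere 0 1) \<and> cmod (g z) \<le> cmod (g y)"
    if "finite S" for S :: "'n set"
    using that
  proof induction
    case empty
    then show ?case using z by auto
  next
    case (insert i S)
    then obtain y where y: "y \<in> cart_power (cball 0 1)" "\<And>j. j \<in> S \<Longrightarrow> y $ j \<in> sphere 0 1"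
      "cmod (g z) \<le> cmod (g y)" by blast
    define \<phi> where "\<phi> = (\<lambda>x. g (\<chi> j. if j = i then x else y $ j))"
    have hol': "\<phi> holomorphic_on ball 0 \<rho>"
      unfolding \<phi>_def by (rule hol[OF y(1)])
    have "cball 0 1 \<subseteq> ball (0::complex) \<rho>" using \<rho> by auto
    then have h: "\<phi> holomorphic_on cball 0 1" by (rule holomorphic_on_subset[OF hol'])
    then have cont: "continuous_on (cball 0 1) \<phi>" by (rule holomorphic_on_imp_continuous_on)
    have "continuous_on (sphere 0 1) (\<lambda>x. cmod (\<phi> x))"
      by (intro continuous_on_norm continuous_on_subset[OF cont]) auto
    moreover have "sphere 0 1 \<noteq> ({} :: complex set)" by simp
    ultimately obtain x where x: "x \<in> sphere 0 1" "\<And>v. v \<in> sphere 0 1 \<Longrightarrow> cmod (\<phi> v) \<le> cmod (\<phi> x)"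
      using continuous_attains_sup[OF compact_sphere] by blast
    have h': "\<phi> holomorphic_on interior (cball 0 1)"
      by (rule holomorphic_on_subset[OF h interior_subset])
    have yi: "y $ i \<in> cball 0 1" using y(1) by (auto simp: cart_power_def)
    have cl: "continuous_on (closure (cball 0 1)) \<phi>" using cont by simp
    have fr: "cmod (\<phi> v) \<le> cmod (\<phi> x)" if "v \<in> frontier (cball 0 1)" for v
      using that x(2) by simp
    have "cmod (\<phi> (y $ i)) \<le> cmod (\<phi> x)"
      by (rule maximum_modulus_frontier[OF h' cl bounded_cball fr yi])
    moreover have "(\<chi> j. if j = i then y $ i else y $ j) = y" by (simp add: vec_eq_iff)
    ultimately have "cmod (g y) \<le> cmod (\<phi> x)" by (simp add: \<phi>_def)
    with x(1) y show ?case
      by (intro bexI[of _ "\<chi> j. if j = i then x else y $ j"]) (auto simp: \<phi>_def cart_power_def)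
  qed
  from this[of UNIV] show ?thesis by (auto simp: cart_power_def)
qed

lemma compact_cart_power:
  assumes "compact S" shows "compact (cart_power S :: (complex ^ 'n) set)"
proof -
  have "cart_power S = (\<Inter>j. (\<lambda>z :: complex ^ 'n. z $ j) -` S)"
    by (auto simp: cart_power_def)
  then have "closed (cart_power S :: (complex ^ 'n) set)"
    using compact_imp_closed[OF assms] by (auto intro!: closed_INT closed_vimage_vec_nth)
  moreover obtain R where R: "\<And>x. x \<in> S \<Longrightarrow> cmod x \<le> R"
    using compact_imp_bounded[OF assms] by (auto simp: bounded_iff)
  have "norm z \<le> (\<Sum>j\<in>(UNIV :: 'n set). R)" if "z \<in> cart_power S" for z :: "complex ^ 'n"
  proof -
    have "norm z \<le> (\<Sum>j\<in>UNIV. cmod (z $ j))"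
      unfolding norm_vec_def by (rule L2_set_le_sum) simp
    also have "\<dots> \<le> (\<Sum>j\<in>(UNIV :: 'n set). R)"
      by (rule sum_mono) (use that R in \<open>auto simp: cart_power_def\<close>)
    finally show ?thesis .
  qed
  then have "bounded (cart_power S :: (complex ^ 'n) set)" unfolding bounded_iff by blast
  ultimately show ?thesis by (simp add: compact_eq_bounded_closed)
qed

lemma closed_polydisc_eq: "closed_polydisc = cart_power (cball 0 1)"
  by (simp add: closed_polydisc_def cart_power_def)

lemma open_polydisc_subset_interior:
  assumes "m > 0" "p > 0" "p dvd m"
  shows "theta_map m p ` cart_power (ball 0 1) \<subseteq> interior (closed_Theta m p)"
  unfolding closed_Theta_def closed_polydisc_eq
  by (intro interior_maximal image_mono open_theta_map_polydisc assms) (auto simp: cart_power_def less_imp_le)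

text \<open>
  A function in the algebra of the closed domain need not be holomorphic near its boundary.  For
  \<open>r < 1\<close> the dilate \<open>z \<mapsto> f (theta_map m p (r *\<^sub>R z))\<close> is holomorphic on a larger polydisc and the
  previous lemma applies to it; compactness of the torus allows \<open>r\<close> to tend to \<open>1\<close>.
\<close>
lemma torus_dominates_disc_algebra:
  fixes f :: "complex ^ 'n::{finite,linorder} \<Rightarrow> complex"
  assumes mp: "m > 0" "p > 0" "p dvd m" and f: "f \<in> disc_algebra (closed_Theta m p)"
    and z: "z \<in> cart_power (cball 0 1)"
  shows "\<exists>t\<in>cart_power (sphere 0 1). cmod (f (theta_map m p z)) \<le> cmod (f (theta_map m p t))"
proof -
  let ?K = "closed_Theta m p :: (complex ^ 'n::{finite,linorder}) set"
  let ?D = "cart_power (cball 0 1) :: (complex ^ 'n::{finite,linorder}) set"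
  define g where "g = (\<lambda>z. f (theta_map m p z))"
  have cont: "continuous_on ?D g"
    unfolding g_def
    by (rule continuous_on_compose2[of ?K f _ "theta_map m p"])
       (use f in \<open>auto simp: disc_algebra_def closed_Theta_def closed_polydisc_eq continuous_theta_map\<close>)
  \<comment> \<open>The slices are holomorphic on the disc of radius \<open>1 / r > 1\<close>, which dilation by \<open>r\<close> maps onto the open unit disc.\<close>
  have shrunk: "\<exists>t\<in>cart_power (sphere 0 1). cmod (g (r *\<^sub>R z)) \<le> cmod (g (r *\<^sub>R t))"
    if r: "0 < r" "r < 1" for r :: real
  proof (rule torus_dominates[where \<rho> = "1 / r" and g = "\<lambda>y. g (r *\<^sub>R y)"])
    fix y :: "complex ^ 'n::{finite,linorder}" and i assume y: "y \<in> ?D"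
    have "(\<lambda>x. f (theta_map m p (r *\<^sub>R (\<chi> j. if j = i then x else y $ j)))) holomorphic_on ball 0 (1 / r)"
    proof (rule holomorphic_several_compose_curve[where U = "interior ?K"])
      show "holomorphic_several f (interior ?K)" using f by (simp add: disc_algebra_def)
      have "(\<lambda>x. (r *\<^sub>R (\<chi> j. if j = i then x else y $ j)) $ k) holomorphic_on ball 0 (1 / r)" for k
        by (cases "k = i") (auto simp: scaleR_conv_of_real intro!: holomorphic_intros)
      then show "(\<lambda>x. theta_map m p (r *\<^sub>R (\<chi> j. if j = i then x else y $ j)) $ k) holomorphic_on ball 0 (1 / r)" for k
        by (rule holomorphic_theta_map_curve)
      have "r *\<^sub>R (\<chi> j. if j = i then x else y $ j) \<in> cart_power (ball 0 1)" if x: "x \<in> ball 0 (1 / r)" for x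
      proof -
        have "r * cmod (y $ j) < 1" for j
        proof -
          have "cmod (y $ j) \<le> 1" using y by (auto simp: cart_power_def)
          then have "r * cmod (y $ j) \<le> r * 1" using r by (intro mult_left_mono) auto
          with r show ?thesis by linarith
        qed
        then show ?thesis using x r by (auto simp: cart_power_def field_simps)
      qed
      then show "(\<lambda>x. theta_map m p (r *\<^sub>R (\<chi> j. if j = i then x else y $ j))) ` ball 0 (1 / r) \<subseteq> interior ?K"
        using open_polydisc_subset_interior[OF mp] by blast
    qed simp
    then show "(\<lambda>x. g (r *\<^sub>R (\<chi> j. if j = i then x else y $ j))) holomorphic_on ball 0 (1 / r)"
      by (simp add: g_def)
  qed (use r z in auto)
  \<comment> \<open>The shift by two keeps every radius strictly between \<open>0\<close> and \<open>1\<close>.\<close>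
  define r where "r = (\<lambda>k. 1 - inverse (real (Suc (Suc k))))"
  have r: "0 < r k" "r k < 1" for k by (auto simp: r_def field_simps)
  have "(\<lambda>k. 1 - inverse (real (Suc (Suc k)))) \<longlonglongrightarrow> 1 - 0"
    by (rule tendsto_diff[OF tendsto_const LIMSEQ_Suc[OF LIMSEQ_inverse_real_of_nat]])
  then have rlim: "r \<longlonglongrightarrow> 1" by (simp add: r_def[abs_def])
  obtain t where t: "\<And>k. t k \<in> cart_power (sphere 0 1)" "\<And>k. cmod (g (r k *\<^sub>R z)) \<le> cmod (g (r k *\<^sub>R t k))"
    using shrunk[OF r] by metis
  obtain s \<sigma> where s: "s \<in> cart_power (sphere 0 1)" "strict_mono (\<sigma> :: nat \<Rightarrow> nat)" "(t \<circ> \<sigma>) \<longlonglongrightarrow> s"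
    using compact_cart_power[OF compact_sphere] t(1) unfolding compact_def by metis
  have in_D: "r k *\<^sub>R y \<in> ?D" if "y \<in> ?D" for y k
    using that r[of k] mult_left_le_one_le[of "cmod (y $ j)" "r k" for j]
    by (auto simp: cart_power_def intro: mult_le_one less_imp_le)
  have sub: "cart_power (sphere 0 1) \<subseteq> ?D" by (auto simp: cart_power_def)
  have r\<sigma>: "(\<lambda>k. r (\<sigma> k)) \<longlonglongrightarrow> 1" using LIMSEQ_subseq_LIMSEQ[OF rlim s(2)] by (simp add: o_def)
  have "(\<lambda>k. r (\<sigma> k) *\<^sub>R z) \<longlonglongrightarrow> 1 *\<^sub>R z" by (intro tendsto_intros r\<sigma>)
  then have lim_z: "(\<lambda>k. g (r (\<sigma> k) *\<^sub>R z)) \<longlonglongrightarrow> g z"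
    by (intro continuous_on_tendsto_compose[OF cont]) (use z in_D in auto)
  have "(\<lambda>k. r (\<sigma> k) *\<^sub>R (t \<circ> \<sigma>) k) \<longlonglongrightarrow> 1 *\<^sub>R s" by (intro tendsto_intros r\<sigma> s)
  moreover have "r (\<sigma> k) *\<^sub>R t (\<sigma> k) \<in> ?D" for k
    using in_D sub t(1) by blast
  ultimately have "(\<lambda>k. g (r (\<sigma> k) *\<^sub>R t (\<sigma> k))) \<longlonglongrightarrow> g s"
    using s(1) sub by (intro continuous_on_tendsto_compose[OF cont]) auto
  with lim_z have "cmod (g z) \<le> cmod (g s)"
    using t(2) by (intro LIMSEQ_le[OF tendsto_norm tendsto_norm]) auto
  with s(1) show ?thesis by (auto simp: g_def)
qed

section \<open>Entire functions on complex n-space\<close>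

lemma holomorphic_several_const: "holomorphic_several (\<lambda>z. c) U"
  unfolding holomorphic_several_def by (auto intro!: exI[of _ "\<lambda>v. 0"])

lemma holomorphic_several_nth: "holomorphic_several (\<lambda>z. z $ i) U"
  unfolding holomorphic_several_def
  by (intro ballI exI[of _ "\<lambda>v. v $ i"]) (auto intro: bounded_linear_imp_has_derivative)

lemma holomorphic_several_add:
  assumes "holomorphic_several f U" "holomorphic_several g U"
  shows "holomorphic_several (\<lambda>z. f z + g z) U"
  unfolding holomorphic_several_def
proof
  fix x assume "x \<in> U"
  then obtain f' g' where "(f has_derivative f') (at x)" "\<And>c v. f' (c *s v) = c * f' v"
    "(g has_derivative g') (at x)" "\<And>c v. g' (c *s v) = c * g' v"
    using assms unfolding holomorphic_several_def by metis
  then show "\<exists>h. ((\<lambda>z. f z + g z) has_derivative h) (at x) \<and> (\<forall>c v. h (c *s v) = c * h v)"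
    by (intro exI[of _ "\<lambda>v. f' v + g' v"] conjI has_derivative_add) (auto simp: algebra_simps)
qed

lemma holomorphic_several_mult:
  assumes "holomorphic_several f U" "holomorphic_several g U"
  shows "holomorphic_several (\<lambda>z. f z * g z) U"
  unfolding holomorphic_several_def
proof
  fix x assume "x \<in> U"
  then obtain f' g' where "(f has_derivative f') (at x)" "\<And>c v. f' (c *s v) = c * f' v"
    "(g has_derivative g') (at x)" "\<And>c v. g' (c *s v) = c * g' v"
    using assms unfolding holomorphic_several_def by metis
  then show "\<exists>h. ((\<lambda>z. f z * g z) has_derivative h) (at x) \<and> (\<forall>c v. h (c *s v) = c * h v)"
    by (intro exI[of _ "\<lambda>v. f x * g' v + f' v * g x"] conjI has_derivative_mult)
       (auto simp: algebra_simps)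
qed

lemma holomorphic_several_sum:
  assumes "\<And>i. i \<in> I \<Longrightarrow> holomorphic_several (f i) U"
  shows "holomorphic_several (\<lambda>z. \<Sum>i\<in>I. f i z) U"
  using assms
  by (induction I rule: infinite_finite_induct)
     (auto intro: holomorphic_several_const holomorphic_several_add)

lemma holomorphic_several_prod:
  assumes "\<And>i. i \<in> I \<Longrightarrow> holomorphic_several (f i) U"
  shows "holomorphic_several (\<lambda>z. \<Prod>i\<in>I. f i z) U"
  using assms
  by (induction I rule: infinite_finite_induct)
     (auto intro: holomorphic_several_const holomorphic_several_mult)

lemma holomorphic_several_power:
  assumes "holomorphic_several f U" shows "holomorphic_several (\<lambda>z. f z ^ k) U"
  by (induction k) (auto intro: holomorphic_several_const holomorphic_several_mult assms)

lemma holomorphic_several_continuous_on: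
  assumes "holomorphic_several f UNIV" shows "continuous_on S f"
  using assms has_derivative_continuous
  by (intro continuous_at_imp_continuous_on) (auto simp: holomorphic_several_def, blast)

lemma entire_in_disc_algebra:
  assumes "holomorphic_several f UNIV" shows "f \<in> disc_algebra K"
  using assms holomorphic_several_continuous_on[OF assms]
  by (auto simp: disc_algebra_def holomorphic_several_def)

text \<open>
  A product of affine functions, one for each point \<open>e\<close> of \<open>E\<close>, each taken in a coordinate in which
  \<open>e\<close> and \<open>w\<close> differ.
\<close>
lemma entire_vanishing_on_finite:
  fixes E :: "(complex ^ 'n) set"
  assumes "finite E" "w \<notin> E"
  shows "\<exists>q. holomorphic_several q UNIV \<and> q w \<noteq> 0 \<and> (\<forall>e\<in>E. q e = 0)"
  using assms
proof (induction E)
  case empty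
  show ?case by (rule exI[of _ "\<lambda>z. 1"]) (simp add: holomorphic_several_const)
next
  case (insert e E)
  then obtain q where q: "holomorphic_several q UNIV" "q w \<noteq> 0" "\<forall>e\<in>E. q e = 0" by auto
  from insert.prems obtain i where i: "w $ i \<noteq> e $ i" by (auto simp: vec_eq_iff)
  have "holomorphic_several (\<lambda>z. q z * (z $ i + (- (e $ i)))) UNIV"
    by (intro holomorphic_several_mult q holomorphic_several_add holomorphic_several_nth holomorphic_several_const)
  with q i show ?case by (intro exI[of _ "\<lambda>z. q z * (z $ i + (- (e $ i)))"]) auto
qed

text \<open>
  A symmetric function of product form descends to an entire function of the image point: after
  factoring \<open>h\<close> into linear factors, \<open>\<Prod>j. (u $ j - c)\<close> is the value at \<open>- c\<close> of the monic
  polynomial attached to \<open>u\<close>, whose coefficients are the elementary symmetric functions of \<open>u\<close>.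
  This replaces the fundamental theorem on symmetric polynomials.
\<close>
lemma entire_prod_poly:
  fixes h :: "complex poly"
  assumes "p dvd m"
  shows "\<exists>F. holomorphic_several F UNIV \<and>
    (\<forall>z :: complex ^ 'n::{finite,linorder}. F (theta_map m p z) = (\<Prod>j\<in>UNIV. poly h ((z $ j) ^ m)))"
proof -
  obtain r where "smult (lead_coeff h) (\<Prod>i<degree h. [:- r i, 1:]) = h"
    using complex_poly_decompose' by blast
  then have h: "poly h x = lead_coeff h * (\<Prod>i<degree h. x + (- r i))" for x
    by (metis (no_types, lifting) poly_smult poly_prod poly_pCons poly_0 mult_1_right add_0_right add.commute mult_zero_right prod.cong)
  define F where "F = (\<lambda>w :: complex ^ 'n::{finite,linorder}.
    lead_coeff h ^ CARD('n) * (\<Prod>i<degree h. poly (monic_poly (pow_last p w)) (- r i)))"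
  have "holomorphic_several (\<lambda>w :: complex ^ 'n::{finite,linorder}. pow_last p w $ i) UNIV" for i
    by (cases "coord_index i = CARD('n)")
       (auto simp: pow_last_def intro!: holomorphic_several_nth holomorphic_several_power)
  then have "holomorphic_several F UNIV"
    unfolding F_def poly_monic_poly
    by (intro holomorphic_several_mult holomorphic_several_const holomorphic_several_prod
        holomorphic_several_add holomorphic_several_sum)
  moreover have "F (theta_map m p z) = (\<Prod>j\<in>UNIV. poly h ((z $ j) ^ m))" for z
  proof -
    have "(\<Prod>j\<in>UNIV. poly h ((z $ j) ^ m)) =
        lead_coeff h ^ CARD('n) * (\<Prod>j\<in>UNIV. \<Prod>i<degree h. (z $ j) ^ m + (- r i))"
      by (simp add: h prod.distrib)
    also have "\<dots> = F (theta_map m p z)"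
      by (subst prod.swap) (simp add: F_def pow_last_theta_map[OF assms] poly_monic_poly_sym_map)
    finally show ?thesis by simp
  qed
  ultimately show ?thesis by blast
qed

section \<open>Polynomials that peak at finitely many points of the circle\<close>

text \<open>
  Each summand is the \<open>N\<close>-th power of a function that has modulus at most \<open>1\<close> on the closed disc and
  reaches it only at \<open>\<tau>\<close>.  For large \<open>N\<close> the sum is therefore close to \<open>1\<close> at the points of \<open>A\<close> and
  small on every compact part of the closed disc that avoids \<open>A\<close>.
\<close>
definition peak_poly :: "complex set \<Rightarrow> nat \<Rightarrow> complex poly"
  where "peak_poly A N = (\<Sum>\<tau>\<in>A. [:1/2, cnj \<tau> / 2:] ^ N)"

lemma poly_peak_poly: "poly (peak_poly A N) x = (\<Sum>\<tau>\<in>A. ((1 + cnj \<tau> * x) / 2) ^ N)"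
  by (simp add: peak_poly_def poly_sum add_divide_distrib mult.commute)

lemma peak_factor_le:
  assumes "cmod \<tau> = 1" "cmod x \<le> 1"
  shows "cmod ((1 + cnj \<tau> * x) / 2) \<le> 1"
proof -
  have "cmod (1 + cnj \<tau> * x) \<le> 1 + 1"
    by (rule order.trans[OF norm_triangle_ineq]) (use assms in \<open>simp add: norm_mult\<close>)
  then show ?thesis by (simp add: norm_divide)
qed

text \<open>
  The only point of the closed unit disc at distance \<open>2\<close> from \<open>- 1\<close> is \<open>1\<close>.
\<close>
lemma peak_factor_less:
  assumes "cmod \<tau> = 1" "cmod x \<le> 1" "x \<noteq> \<tau>"
  shows "cmod ((1 + cnj \<tau> * x) / 2) < 1"
proof -
  define y where "y = cnj \<tau> * x"
  have y: "cmod y \<le> 1" using assms by (simp add: y_def norm_mult)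
  have "\<tau> * cnj \<tau> = 1" using assms(1) by (simp add: complex_norm_square[symmetric])
  then have "y \<noteq> 1" using assms(3) unfolding y_def
    by (metis mult.assoc mult.commute mult_1_left)
  have sq: "(Re y)\<^sup>2 + (Im y)\<^sup>2 \<le> 1"
    using y power_mono[of "cmod y" 1 2] by (simp add: cmod_power2[symmetric])
  have "Re y \<noteq> 1"
  proof
    assume "Re y = 1"
    with sq have "Im y = 0" by simp
    with \<open>Re y = 1\<close> \<open>y \<noteq> 1\<close> show False by (simp add: complex_eq_iff)
  qed
  moreover have "Re y \<le> 1" using complex_Re_le_cmod[of y] y by linarith
  ultimately have "Re y < 1" by simp
  with sq have "(1 + Re y)\<^sup>2 + (Im y)\<^sup>2 < 2\<^sup>2" by (simp add: power2_eq_square algebra_simps)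
  then have "(cmod (1 + y))\<^sup>2 < 2\<^sup>2" by (simp add: cmod_power2)
  then have "cmod (1 + y) < 2" by (rule power_less_imp_less_base) simp
  then show ?thesis by (simp add: norm_divide y_def)
qed

lemma peak_poly_bound:
  assumes "A \<subseteq> sphere 0 1" "cmod x \<le> 1"
  shows "cmod (poly (peak_poly A N) x) \<le> card A"
proof -
  have "cmod (poly (peak_poly A N) x) \<le> (\<Sum>\<tau>\<in>A. 1)"
    unfolding poly_peak_poly
    using assms peak_factor_le
    by (intro order.trans[OF norm_sum] sum_mono) (auto simp: norm_power intro!: power_le_one)
  then show ?thesis by simp
qed

text \<open>
  Base and exponent vary together, as they do along a subsequence of maximum points for
  peak polynomials of increasing order.
\<close>
lemma power_varying_tendsto_0:
  fixes a :: "nat \<Rightarrow> complex"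
  assumes "a \<longlonglongrightarrow> l" "cmod l < 1" "strict_mono \<sigma>"
  shows "(\<lambda>k. a k ^ \<sigma> k) \<longlonglongrightarrow> 0"
proof -
  obtain c where c: "cmod l < c" "c < 1" using assms(2) dense by blast
  then have c0: "0 \<le> c" using norm_ge_zero[of l] by linarith
  have "(\<lambda>k. cmod (a k)) \<longlonglongrightarrow> cmod l" by (intro tendsto_norm assms)
  then have "\<forall>\<^sub>F k in sequentially. cmod (a k) < c" using c(1) by (rule order_tendstoD)
  then have "\<forall>\<^sub>F k in sequentially. norm (a k ^ \<sigma> k) \<le> c ^ k"
  proof eventually_elim
    case (elim k)
    have "cmod (a k) ^ \<sigma> k \<le> c ^ \<sigma> k" using elim by (intro power_mono) auto
    also have "\<dots> \<le> c ^ k" using c c0 seq_suble[OF assms(3)] by (intro power_decreasing) auto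
    finally show ?case by (simp add: norm_power)
  qed
  moreover have "(\<lambda>k. c ^ k) \<longlonglongrightarrow> 0" using c c0 by (intro LIMSEQ_realpow_zero) auto
  ultimately show ?thesis by (rule Lim_null_comparison)
qed

lemma peak_poly_tendsto_0:
  assumes "finite A" "A \<subseteq> sphere 0 1" "x \<longlonglongrightarrow> l" "cmod l \<le> 1" "l \<notin> A" "strict_mono \<sigma>"
  shows "(\<lambda>k. poly (peak_poly A (\<sigma> k)) (x k)) \<longlonglongrightarrow> 0"
proof -
  have "(\<lambda>k. ((1 + cnj \<tau> * x k) / 2) ^ \<sigma> k) \<longlonglongrightarrow> 0" if "\<tau> \<in> A" for \<tau>
  proof (rule power_varying_tendsto_0[where l = "(1 + cnj \<tau> * l) / 2"])
    show "(\<lambda>k. (1 + cnj \<tau> * x k) / 2) \<longlonglongrightarrow> (1 + cnj \<tau> * l) / 2"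
      by (intro tendsto_intros assms) simp
    show "cmod ((1 + cnj \<tau> * l) / 2) < 1"
      by (rule peak_factor_less) (use that assms in auto)
  qed fact
  then have "(\<lambda>k. \<Sum>\<tau>\<in>A. ((1 + cnj \<tau> * x k) / 2) ^ \<sigma> k) \<longlonglongrightarrow> (\<Sum>\<tau>\<in>A. 0)"
    by (intro tendsto_sum)
  then show ?thesis by (simp add: poly_peak_poly)
qed

lemma peak_poly_tendsto_1:
  assumes "finite A" "A \<subseteq> sphere 0 1" "x \<in> A"
  shows "(\<lambda>N. poly (peak_poly A N) x) \<longlonglongrightarrow> 1"
proof -
  have "cnj x * x = 1" using assms by (auto simp: complex_norm_square[symmetric] mult.commute)
  then have "poly (peak_poly A N) x = 1 + poly (peak_poly (A - {x}) N) x" for N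
    using assms by (simp add: poly_peak_poly sum.remove[of A x])
  moreover have "(\<lambda>N. 1 + poly (peak_poly (A - {x}) (id N)) x) \<longlonglongrightarrow> 1 + 0"
    by (intro tendsto_add tendsto_const peak_poly_tendsto_0)
       (use assms in \<open>auto simp: strict_mono_def\<close>)
  ultimately show ?thesis by simp
qed

section \<open>Almost peak functions and the Shilov boundary\<close>

lemma finite_cart_power:
  assumes "finite S" shows "finite (cart_power S :: (complex ^ 'n) set)"
proof (rule finite_subset)
  show "(cart_power S :: (complex ^ 'n) set) \<subseteq> vec_lambda ` (\<Pi>\<^sub>E j\<in>UNIV. S)"
    by (auto simp: cart_power_def image_iff PiE_iff intro!: bexI[of _ "\<lambda>j. _ $ j"])
  show "finite (vec_lambda ` (\<Pi>\<^sub>E j\<in>(UNIV :: 'n set). S))"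
    using assms by (intro finite_imageI finite_PiE) auto
qed

lemma finite_power_preimage:
  fixes A :: "complex set"
  assumes "finite A" "m > 0" shows "finite {x. x ^ m \<in> A}"
proof -
  have "finite {x :: complex. x ^ m = a}" for a using finite_nth_roots[OF assms(2)] .
  then have "finite (\<Union>a\<in>A. {x :: complex. x ^ m = a})" using assms(1) by blast
  moreover have "{x. x ^ m \<in> A} = (\<Union>a\<in>A. {x. x ^ m = a})" by auto
  ultimately show ?thesis by simp
qed

lemma null_mult_bounded:
  fixes a b :: "nat \<Rightarrow> complex"
  assumes "a \<longlonglongrightarrow> 0" "\<And>k. cmod (b k) \<le> M"
  shows "(\<lambda>k. a k * b k) \<longlonglongrightarrow> 0"
proof (rule Lim_null_comparison)
  show "\<forall>\<^sub>F k in sequentially. norm (a k * b k) \<le> norm (a k) * M"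
    using assms(2) by (auto simp: norm_mult intro!: mult_left_mono always_eventually)
  show "(\<lambda>k. norm (a k) * M) \<longlonglongrightarrow> 0"
    using tendsto_mult_left_zero[OF tendsto_norm_zero[OF assms(1)]] .
qed

text \<open>
  The function is \<open>q\<close> times the descent of \<open>\<Prod>j. poly (peak_poly A N) ((z $ j) ^ m)\<close> for large \<open>N\<close>,
  where \<open>A\<close> consists of the numbers \<open>(t $ j) ^ m\<close>.  The product becomes small unless every
  \<open>(z $ j) ^ m\<close> is close to \<open>A\<close>.  That leaves neighbourhoods of finitely many points \<open>z\<close>, among which
  \<open>t\<close> is not singled out, since values in \<open>A\<close> may occur with the wrong multiplicities or the last
  coordinate may differ by a root of unity.  The factor \<open>q\<close> removes those with another image
  than \<open>t\<close>.  If no \<open>N\<close> worked, a limit point of the offending points would contradict this.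
\<close>
lemma almost_peak_function:
  fixes t :: "complex ^ 'n::{finite,linorder}"
  assumes mp: "m > 0" "p dvd m" and t: "t \<in> cart_power (sphere 0 1)"
    and U: "open U" "theta_map m p t \<in> U"
  shows "\<exists>F \<in> disc_algebra (closed_Theta m p).
    \<forall>y \<in> closed_Theta m p - U. cmod (F y) < cmod (F (theta_map m p t))"
proof (rule ccontr)
  assume neg: "\<not> ?thesis"
  let ?D = "cart_power (cball 0 1) :: (complex ^ 'n::{finite,linorder}) set"
  define A where "A = range (\<lambda>j. (t $ j) ^ m)"
  have A: "finite A" "A \<subseteq> sphere 0 1"
    using t by (auto simp: A_def cart_power_def norm_power)
  \<comment> \<open>These finitely many points are the ones that the product of peak polynomials cannot tell apart from \<open>t\<close>.\<close>
  define E :: "(complex ^ 'n::{finite,linorder}) set" where "E = cart_power {x. x ^ m \<in> A}"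
  have "finite E" unfolding E_def by (intro finite_cart_power finite_power_preimage A mp)
  then obtain q where q: "holomorphic_several q UNIV" "q (theta_map m p t) \<noteq> 0"
      "\<And>e. e \<in> E \<Longrightarrow> theta_map m p e \<noteq> theta_map m p t \<Longrightarrow> q (theta_map m p e) = 0"
    using entire_vanishing_on_finite[of "theta_map m p ` E - {theta_map m p t}" "theta_map m p t"]
    by (auto simp: Ball_def)
  have "\<forall>N. \<exists>F. holomorphic_several F UNIV \<and>
      (\<forall>z :: complex ^ 'n::{finite,linorder}. F (theta_map m p z) = (\<Prod>j\<in>UNIV. poly (peak_poly A N) ((z $ j) ^ m)))"
    using entire_prod_poly[OF mp(2)] by blast
  then obtain H where H: "\<And>N. holomorphic_several (H N) UNIV"
    "\<And>N z. H N (theta_map m p (z :: complex ^ 'n::{finite,linorder})) =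
       (\<Prod>j\<in>UNIV. poly (peak_poly A N) ((z $ j) ^ m))" by metis
  define F where "F = (\<lambda>N z. q z * H N z)"
  have "F N \<in> disc_algebra (closed_Theta m p)" for N
    unfolding F_def by (intro entire_in_disc_algebra holomorphic_several_mult q H)
  with neg have "\<forall>N. \<exists>y \<in> closed_Theta m p - U. cmod (F N (theta_map m p t)) \<le> cmod (F N y)"
    by (metis linorder_not_less)
  then have "\<forall>N. \<exists>z \<in> ?D. theta_map m p z \<notin> U \<and> cmod (F N (theta_map m p t)) \<le> cmod (F N (theta_map m p z))"
    unfolding closed_Theta_def closed_polydisc_eq by blast
  then obtain z where z: "\<And>N. z N \<in> ?D" "\<And>N. theta_map m p (z N) \<notin> U"
    "\<And>N. cmod (F N (theta_map m p t)) \<le> cmod (F N (theta_map m p (z N)))" by metis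
  obtain l \<sigma> where l: "l \<in> ?D" "strict_mono (\<sigma> :: nat \<Rightarrow> nat)" "(z \<circ> \<sigma>) \<longlonglongrightarrow> l"
    using compact_cart_power[OF compact_cball] z(1) unfolding compact_def by metis
  have lim_\<theta>: "(\<lambda>k. theta_map m p (z (\<sigma> k))) \<longlonglongrightarrow> theta_map m p l"
    using continuous_on_tendsto_compose[OF continuous_theta_map[of UNIV m p] l(3)] by simp
  have "theta_map m p l \<notin> U"
    using closed_sequentially[OF _ _ lim_\<theta>, of "- U"] U(1) z(2) by auto
  then have l_ne: "theta_map m p l \<noteq> theta_map m p t" using U(2) by auto
  have lim_q: "(\<lambda>k. q (theta_map m p (z (\<sigma> k)))) \<longlonglongrightarrow> q (theta_map m p l)"
    using continuous_on_tendsto_compose[OF holomorphic_several_continuous_on[OF q(1), of UNIV] lim_\<theta>] by simp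
  define h where "h = (\<lambda>k j. poly (peak_poly A (\<sigma> k)) ((z (\<sigma> k) $ j) ^ m))"
  have h_le: "cmod (h k j) \<le> card A" for k j
    unfolding h_def using z(1)[of "\<sigma> k"]
    by (intro peak_poly_bound A) (auto simp: cart_power_def norm_power intro!: power_le_one)
  have lim_F: "(\<lambda>k. q (theta_map m p (z (\<sigma> k))) * (\<Prod>j\<in>UNIV. h k j)) \<longlonglongrightarrow> 0"
  proof (cases "l \<in> E")
    case True
    \<comment> \<open>The limit point is one of the exceptional points, and \<open>q\<close> vanishes at its image.\<close>
    with l_ne q(3) lim_q have q0: "(\<lambda>k. q (theta_map m p (z (\<sigma> k)))) \<longlonglongrightarrow> 0" by simp
    have "cmod (\<Prod>j\<in>UNIV. h k j) \<le> (\<Prod>j\<in>(UNIV :: 'n set). real (card A))" for k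
      unfolding prod_norm[symmetric] by (intro prod_mono) (simp add: h_le)
    then show ?thesis
      by (intro null_mult_bounded[OF q0, of _ "\<Prod>j\<in>(UNIV :: 'n set). real (card A)"]) auto
  next
    case False
    \<comment> \<open>One factor of the product tends to \<open>0\<close>, and all others stay bounded.\<close>
    then obtain i where i: "(l $ i) ^ m \<notin> A" by (auto simp: E_def cart_power_def)
    have "(\<lambda>k. (z (\<sigma> k) $ i) ^ m) \<longlonglongrightarrow> (l $ i) ^ m"
      using l(3) by (intro tendsto_intros) (simp add: o_def)
    then have h0: "(\<lambda>k. h k i) \<longlonglongrightarrow> 0"
      unfolding h_def
      by (rule peak_poly_tendsto_0[OF A])
         (use l i in \<open>auto simp: cart_power_def norm_power intro!: power_le_one\<close>)
    have bd: "cmod (\<Prod>j\<in>UNIV - {i}. h k j) \<le> (\<Prod>j\<in>(UNIV :: 'n set) - {i}. real (card A))" for k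
      unfolding prod_norm[symmetric] by (intro prod_mono) (simp add: h_le)
    have "(\<lambda>k. h k i * (\<Prod>j\<in>UNIV - {i}. h k j)) \<longlonglongrightarrow> 0"
      by (intro null_mult_bounded[OF h0, of _ "\<Prod>j\<in>(UNIV :: 'n set) - {i}. real (card A)"]) (rule bd)
    then have "(\<lambda>k. \<Prod>j\<in>UNIV. h k j) \<longlonglongrightarrow> 0"
      by (simp add: prod.remove[of UNIV i])
    from tendsto_mult[OF lim_q this] show ?thesis by simp
  qed
  have "(\<lambda>N. F N (theta_map m p t)) \<longlonglongrightarrow> q (theta_map m p t) * (\<Prod>j\<in>(UNIV :: 'n set). 1)"
    unfolding F_def H(2)
    by (intro tendsto_mult tendsto_const tendsto_prod peak_poly_tendsto_1 A) (auto simp: A_def)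
  then have "(\<lambda>k. F (\<sigma> k) (theta_map m p t)) \<longlonglongrightarrow> q (theta_map m p t)"
    using LIMSEQ_subseq_LIMSEQ[OF _ l(2)] by (fastforce simp: o_def)
  moreover have "(\<lambda>k. F (\<sigma> k) (theta_map m p (z (\<sigma> k)))) \<longlonglongrightarrow> 0"
    using lim_F by (simp add: F_def H(2) h_def)
  ultimately have "cmod (q (theta_map m p t)) \<le> cmod 0"
    using z(3) by (intro LIMSEQ_le[OF tendsto_norm tendsto_norm]) auto
  with q(2) show False by simp
qed

text \<open>
  The image of the torus has the maximum property because the torus dominates the polydisc, and it
  is contained in every closed set with this property because such a set meets every
  neighbourhood of a point that has almost peak functions.
\<close>
lemma shilov_boundary_closed_Theta:
  assumes mp: "m > 0" "p > 0" "p dvd m"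
  shows "shilov_boundary (closed_Theta m p :: (complex ^ 'n::{finite,linorder}) set) =
    theta_map m p ` cart_power (sphere 0 1)"
  unfolding shilov_boundary_def
proof (rule Least_equality)
  let ?K = "closed_Theta m p :: (complex ^ 'n::{finite,linorder}) set"
  let ?B = "theta_map m p ` cart_power (sphere 0 1) :: (complex ^ 'n::{finite,linorder}) set"
  have comp: "compact ?B"
    by (intro compact_continuous_image continuous_theta_map compact_cart_power compact_sphere)
  have sub: "?B \<subseteq> ?K"
    unfolding closed_Theta_def closed_polydisc_eq by (intro image_mono) (auto simp: cart_power_def)
  have "\<exists>x\<in>?B. \<forall>y\<in>?K. cmod (f y) \<le> cmod (f x)" if f: "f \<in> disc_algebra ?K" for f
  proof -
    have "continuous_on ?B (\<lambda>x. cmod (f x))"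
      using f sub by (intro continuous_on_norm) (auto simp: disc_algebra_def intro: continuous_on_subset)
    moreover have "(\<chi> j. 1) \<in> (cart_power (sphere 0 1) :: (complex ^ 'n::{finite,linorder}) set)"
      by (simp add: cart_power_def)
    then have "?B \<noteq> {}" by blast
    ultimately obtain x where x: "x \<in> ?B" "\<And>y. y \<in> ?B \<Longrightarrow> cmod (f y) \<le> cmod (f x)"
      using continuous_attains_sup[OF comp] by blast
    have "cmod (f y) \<le> cmod (f x)" if "y \<in> ?K" for y
    proof -
      from that obtain z where "z \<in> cart_power (cball 0 1)" "y = theta_map m p z"
        by (auto simp: closed_Theta_def closed_polydisc_eq)
      then show ?thesis
        using torus_dominates_disc_algebra[OF mp f] x(2) by (meson imageI order_trans)
    qed
    with x(1) show ?thesis by blast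
  qed
  with comp sub show "max_modulus_set ?K ?B"
    by (auto simp: max_modulus_set_def compact_imp_closed)
next
  fix B :: "(complex ^ 'n::{finite,linorder}) set"
  assume B: "max_modulus_set (closed_Theta m p) B"
  have "theta_map m p t \<in> B" if t: "t \<in> cart_power (sphere 0 1)" for t
  proof (rule ccontr)
    assume "theta_map m p t \<notin> B"
    with B have "open (- B)" "theta_map m p t \<in> - B" by (auto simp: max_modulus_set_def)
    from almost_peak_function[OF mp(1,3) t this] obtain F
      where F: "F \<in> disc_algebra (closed_Theta m p)"
        "\<And>y. y \<in> B \<Longrightarrow> y \<in> closed_Theta m p \<Longrightarrow> cmod (F y) < cmod (F (theta_map m p t))" by auto
    have "theta_map m p t \<in> closed_Theta m p"
      using t by (auto simp: closed_Theta_def closed_polydisc_eq cart_power_def)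
    with B F show False
      unfolding max_modulus_set_def by (metis linorder_not_less subsetD)
  qed
  then show "theta_map m p ` cart_power (sphere 0 1) \<le> B" by blast
qed

theorem proposition2p9:
  fixes m p :: nat and \<theta> :: "complex ^ 'n::{finite,linorder}"
  assumes "m > 0" and "p > 0" and "p dvd m" and "CARD('n) \<ge> 2"
  shows "\<theta> \<in> b_Theta m p \<longleftrightarrow>
    (\<chi> i. if coord_index i = CARD('n) then (\<theta> $ i) ^ p else \<theta> $ i) \<in> b_Gamma"
proof -
  have "b_Theta m p = (theta_map m p ` cart_power (sphere 0 1) :: (complex ^ 'n::{finite,linorder}) set)"
    unfolding b_Theta_def by (rule shilov_boundary_closed_Theta) fact+
  moreover have "b_Gamma = (sym_map ` cart_power (sphere 0 1) :: (complex ^ 'n::{finite,linorder}) set)"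
    using shilov_boundary_closed_Theta[of 1 1]
    unfolding b_Gamma_def Gamma_set_def closed_Theta_def theta_map_1 by simp
  ultimately show ?thesis
    using theta_map_image_iff[OF assms(1-3) power_mem_sphere_iff[OF assms(1)], of \<theta>]
    by (simp add: pow_last_def)
qed

end
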